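(* Let $G$ be a finite connected graph. Let $\mathcal{B}_G$ be the set of all balanced tours on $G$ and $\mathcal{E}_G$ the set of all tours of even length on $G$ (with any starting vertex), where the size of a tour is half its length, and let $\mathcal{B}_{G,k}$, $\mathcal{E}_{G,k}$ denote the tours of size $k$ in these sets. Then the growth rate of $\mathcal{B}_G$ is equal to the growth rate of $\mathcal{E}_G$, i.e. $\lim_{k\to\infty}|\mathcal{B}_{G,k}|^{1/k}=\lim_{k\to\infty}|\mathcal{E}_{G,k}|^{1/k}$.
   Context: A walk of length $\ell$ on a graph is a sequence $v_0,f_1,v_1,f_2,\dots,f_\ell,v_\ell$ of vertices and edges in which the endvertices of $f_i$ are $v_{i-1}$ and $v_i$; it is a tour if $v_\ell=v_0$ (its starting vertex). A tour is balanced if, for every edge, the number of times the tour traverses it in one direction equals the number of times it traverses it in the other direction. The growth rate of a collection of objects with finitely many of each size $k$ is $\lim_{k\to\infty}(\text{number of size-}k\text{ objects})^{1/k}$. *)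

theory Defs
  imports Complex_Main "Graph_Theory.Graph_Theory"
begin

text \<open>
  A finite undirected graph, parallel edges allowed, is given by the two orientations of each of
  its edges: every edge is a pair \<open>{a, arev a}\<close> of mutually reverse arcs of \<open>G\<close>.
  Loops are excluded, since a walk v, f, v along a loop f has no direction of traversal.
  The simple graphs (locale \<open>graph\<close>) are the instances without multiple arcs, see the
  lemma \<open>graph_imp_fin_graph\<close> below.
\<close>
locale fin_graph = fin_digraph G + loopfree_digraph G + bidirected_digraph G arev
  for G :: "('a, 'b) pre_digraph" and arev :: "'b \<Rightarrow> 'b"

text \<open>
  The walk \<open>v\<^sub>0, f\<^sub>1, v\<^sub>1, \<dots>, f\<^sub>n, v\<^sub>n\<close> is the pair of its starting vertex \<open>v\<^sub>0\<close> and the list of the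
  arcs \<open>f\<^sub>i\<close> oriented from \<open>v\<^bsub>i-1\<^esub>\<close> to \<open>v\<^sub>i\<close>. The starting vertex is determined by the arcs unless
  the walk has length 0.
\<close>
definition tours :: "('a, 'b) pre_digraph \<Rightarrow> ('a \<times> 'b awalk) set" where
  "tours G = {(u, p). pre_digraph.awalk G u p u}"

definition tour_length :: "'a \<times> 'b awalk \<Rightarrow> nat" where
  "tour_length t = length (snd t)"

definition tour_size :: "'a \<times> 'b awalk \<Rightarrow> real" where
  "tour_size t = real (tour_length t) / 2"

definition balanced :: "('a, 'b) pre_digraph \<Rightarrow> ('b \<Rightarrow> 'b) \<Rightarrow> 'a \<times> 'b awalk \<Rightarrow> bool" where
  "balanced G arev t \<longleftrightarrow>
     (\<forall>a \<in> arcs G. count_list (snd t) a = count_list (snd t) (arev a))"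

definition balanced_tours :: "('a, 'b) pre_digraph \<Rightarrow> ('b \<Rightarrow> 'b) \<Rightarrow> ('a \<times> 'b awalk) set" where
  "balanced_tours G arev = {t \<in> tours G. balanced G arev t}"

definition even_tours :: "('a, 'b) pre_digraph \<Rightarrow> ('a \<times> 'b awalk) set" where
  "even_tours G = {t \<in> tours G. even (tour_length t)}"

definition of_size :: "('c \<Rightarrow> real) \<Rightarrow> 'c set \<Rightarrow> nat \<Rightarrow> 'c set" where
  "of_size sz C k = {x \<in> C. sz x = real k}"

text \<open>The finiteness condition guards against \<^const>\<open>card\<close> being 0 on infinite sets.\<close>
definition has_growth_rate :: "('c \<Rightarrow> real) \<Rightarrow> 'c set \<Rightarrow> real \<Rightarrow> bool" where
  "has_growth_rate sz C L \<longleftrightarrow>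
     (\<forall>k. finite (of_size sz C k)) \<and>
     (\<lambda>k. root k (real (card (of_size sz C k)))) \<longlonglongrightarrow> L"

lemma graph_imp_fin_graph:
  assumes "graph G"
  shows "\<exists>arev. fin_graph G arev"
proof -
  interpret graph G by fact
  define rev where "rev a = (if a \<in> arcs G
      then SOME b. b \<in> arcs G \<and> tail G b = head G a \<and> head G b = tail G a else a)" for a
  have rev: "rev a \<in> arcs G" "tail G (rev a) = head G a" "head G (rev a) = tail G a"
    if a: "a \<in> arcs G" for a
  proof -
    have "(head G a, tail G a) \<in> arcs_ends G"
      using a by (auto intro: arcs_ends_symmetric in_arcs_imp_in_arcs_ends)
    then obtain b where "b \<in> arcs G \<and> tail G b = head G a \<and> head G b = tail G a"
      by (auto simp: arcs_ends_def arc_to_ends_def)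
    then have "rev a \<in> arcs G \<and> tail G (rev a) = head G a \<and> head G (rev a) = tail G a"
      unfolding rev_def if_P[OF a] by (rule someI)
    then show "rev a \<in> arcs G" "tail G (rev a) = head G a" "head G (rev a) = tail G a"
      by auto
  qed
  have "bidirected_digraph G rev"
  proof (rule bidirected_digraphI)
    show "rev a = a" if "a \<notin> arcs G" for a using that by (simp add: rev_def)
    show "rev a \<noteq> a" if "a \<in> arcs G" for a using rev(2)[OF that] no_loops[OF that] by auto
    show "rev (rev a) = a" if "a \<in> arcs G" for a
      using that by (intro no_multi_arcs) (simp_all add: rev arc_to_ends_def)
    show "tail G (rev a) = head G a" if "a \<in> arcs G" for a using that by (rule rev)
  qed
  then have "fin_graph G rev"
    by (intro fin_graph.intro fin_digraph_axioms loopfree_digraph_axioms)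
  then show ?thesis by blast
qed

end

(* Let w k be the number of walks of length k with arbitrary ends. It is submultiplicative, so
   (w k)^(1/k) converges to some l. Cutting a tour of length 2k in the middle shows that there are
   at most (w k)^2 of them. Conversely, a walk followed by the reverse of another one with the same
   ends is a tour, and it is balanced if both walks have the same imbalance on every edge. The
   ends and the imbalances of walks of length k take only polynomially many values P k in total,
   so Cauchy-Schwarz yields at least (w k)^2 / P k balanced tours of length 2k. Both growth rates
   are therefore l^2. *)
theory Submission
  imports Defs "HOL-Analysis.Convex"
begin

section \<open>Limits of roots and an inequality for collisions\<close>

lemma submultiplicative_root_tendsto:
  fixes w :: "nat \<Rightarrow> real"
  assumes nonneg: "\<And>n. 0 \<le> w n"
    and submult: "\<And>m n. w (m + n) \<le> w m * w n"
  shows "\<exists>l. (\<lambda>n. root n (w n)) \<longlonglongrightarrow> l"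
proof -
  \<comment> \<open>This is Fekete's lemma in multiplicative form: the limit is the infimum. The
    index 0 is left out because \<open>root 0\<close> is constantly 0.\<close>
  define l where "l = (INF n\<in>{0<..}. root n (w n))"
  have bdd: "bdd_below ((\<lambda>n. root n (w n)) ` {0<..})"
    by (rule bdd_belowI[of _ 0]) (auto simp: nonneg)
  have l_le: "l \<le> root n (w n)" if "n > 0" for n
    unfolding l_def using that by (intro cINF_lower bdd) auto
  have l_nonneg: "0 \<le> l"
    unfolding l_def by (intro cINF_greatest) (auto simp: nonneg)
  have upper: "\<forall>\<^sub>F n in sequentially. root n (w n) < d" if "l < d" for d
  proof -
    \<comment> \<open>Strict room on both sides: some \<open>root m (w m)\<close> lies below
      \<open>c\<close>, and the gap from \<open>c\<close> to \<open>d\<close> absorbs a constant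
      factor whose n-th root tends to 1.\<close>
    define c where "c = (l + d) / 2"
    have c: "l < c" "c < d" "0 < c"
      using that l_nonneg by (auto simp: c_def field_simps)
    obtain m where m: "m > 0" "root m (w m) < c"
      using c(1) cINF_less_iff[OF _ bdd, of c] unfolding l_def by auto
    have wm: "w m \<le> c ^ m"
      using m nonneg[of m] by (metis less_eq_real_def power_mono real_root_ge_zero real_root_pow_pos2)
    \<comment> \<open>One constant that dominates \<open>w r / c ^ r\<close> for all remainders
      \<open>r < m\<close>; the summand 1 keeps it positive, so that \<open>root n K\<close> tends
      to 1.\<close>
    define K where "K = 1 + (\<Sum>r<m. w r / c ^ r)"
    have K_pos: "0 < K"
      unfolding K_def using c nonneg by (intro add_pos_nonneg sum_nonneg) auto
    have bound: "w n \<le> K * c ^ n" for n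
    proof -
      define r where "r = n mod m"
      \<comment> \<open>Split a length into \<open>q\<close> blocks of length \<open>m\<close> and a
        remainder; each block costs a factor of at most \<open>c ^ m\<close>.\<close>
      have step: "w (q * m + r) \<le> (c ^ m) ^ q * w r" for q
      proof (induction q)
        case (Suc q)
        have "w (Suc q * m + r) \<le> w m * w (q * m + r)"
          using submult[of m "q * m + r"] by (simp add: algebra_simps)
        also have "\<dots> \<le> c ^ m * ((c ^ m) ^ q * w r)"
          using Suc wm nonneg c by (intro mult_mono) auto
        finally show ?case by (simp add: algebra_simps)
      qed simp
      have n: "n = n div m * m + r"
        by (simp add: r_def)
      have "w r / c ^ r \<le> (\<Sum>r<m. w r / c ^ r)"
        using m c nonneg by (intro member_le_sum) (auto simp: r_def)
      then have "w r / c ^ r \<le> K"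
        by (simp add: K_def)
      then have "w r \<le> K * c ^ r"
        using c by (simp add: pos_divide_le_eq)
      then have "(c ^ m) ^ (n div m) * w r \<le> (c ^ m) ^ (n div m) * (K * c ^ r)"
        using c by (intro mult_left_mono) auto
      also have "\<dots> = K * c ^ (n div m * m + r)"
        by (simp add: power_add power_mult power_mult_distrib mult.commute flip: power_mult)
      finally have "w (n div m * m + r) \<le> K * c ^ (n div m * m + r)"
        using step[of "n div m"] by linarith
      then show ?thesis
        using n by simp
    qed
    have "(\<lambda>n. root n K * c) \<longlonglongrightarrow> 1 * c"
      by (intro tendsto_intros LIMSEQ_root_const K_pos)
    then have "\<forall>\<^sub>F n in sequentially. root n K * c < d"
      using c by (intro order_tendstoD) auto
    then show ?thesis
      using eventually_gt_at_top[of 0]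
    proof eventually_elim
      case (elim n)
      have "root n (w n) \<le> root n (K * c ^ n)"
        using elim bound by simp
      also have "\<dots> = root n K * c"
        using elim c by (simp add: real_root_mult real_root_power_cancel)
      finally show ?case using elim by simp
    qed
  qed
  have "(\<lambda>n. root n (w n)) \<longlonglongrightarrow> l"
  proof (rule order_tendstoI)
    show "\<forall>\<^sub>F n in sequentially. d < root n (w n)" if "d < l" for d
      using eventually_gt_at_top[of 0]
      by eventually_elim (rule less_le_trans[OF that l_le])
  qed (rule upper)
  then show ?thesis ..
qed

text \<open>Polynomial losses do not change a growth rate. For k > 0 this follows from 2k + 1 \<le>
  3k and the convergence of \<open>root k k\<close> to 1.\<close>

lemma root_polynomial_tendsto:
  fixes c :: real
  assumes "c > 0"
  shows "(\<lambda>k. root k (c * (2 * real k + 1) ^ m)) \<longlonglongrightarrow> 1"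
proof -
  have "(\<lambda>k. root k (2 * real k + 1)) \<longlonglongrightarrow> 1"
  proof (rule tendsto_sandwich)
    show "\<forall>\<^sub>F k in sequentially. 1 \<le> root k (2 * real k + 1)"
      using eventually_gt_at_top[of 0] by eventually_elim simp
    show "\<forall>\<^sub>F k in sequentially. root k (2 * real k + 1) \<le> root k 3 * root k k"
      using eventually_gt_at_top[of 0]
      by eventually_elim (simp flip: real_root_mult)
    show "(\<lambda>k. root k 3 * root k k) \<longlonglongrightarrow> 1"
      using tendsto_mult[OF LIMSEQ_root_const LIMSEQ_root, of 3] by simp
  qed simp
  then have "(\<lambda>k. root k c * root k (2 * real k + 1) ^ m) \<longlonglongrightarrow> 1 * 1 ^ m"
    by (intro tendsto_mult tendsto_power LIMSEQ_root_const assms)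
  moreover have "\<forall>\<^sub>F k in sequentially.
      root k c * root k (2 * real k + 1) ^ m = root k (c * (2 * real k + 1) ^ m)"
    using eventually_gt_at_top[of 0]
    by eventually_elim (simp add: real_root_mult real_root_power)
  ultimately show ?thesis
    by (simp add: tendsto_cong)
qed

text \<open>Cauchy-Schwarz on the fibres of \<open>f\<close>: their sizes add up to
  \<open>card A\<close>, and the squares of their sizes add up to the number of colliding
  pairs.\<close>

lemma card_power2_le_card_collisions:
  assumes "finite A" "finite S" "f ` A \<subseteq> S"
  shows "(card A)\<^sup>2 \<le> card S * card {(x, y) \<in> A \<times> A. f x = f y}"
proof -
  let ?N = "\<lambda>s. card {x \<in> A. f x = s}"
  have "card A = (\<Sum>s\<in>S. ?N s)"
    using sum.group[OF assms, of "\<lambda>_. 1 :: nat"] by simp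
  moreover have "card {(x, y) \<in> A \<times> A. f x = f y} = (\<Sum>s\<in>S. (?N s)\<^sup>2)"
  proof -
    have "{(x, y) \<in> A \<times> A. f x = f y} = (SIGMA x:A. {y \<in> A. f y = f x})"
      by auto
    then have "card {(x, y) \<in> A \<times> A. f x = f y} = (\<Sum>x\<in>A. ?N (f x))"
      using assms by simp
    also have "\<dots> = (\<Sum>s\<in>S. \<Sum>x\<in>{x \<in> A. f x = s}. ?N (f x))"
      by (rule sum.group[OF assms, symmetric])
    also have "\<dots> = (\<Sum>s\<in>S. (?N s)\<^sup>2)"
      by (simp add: power2_eq_square)
    finally show ?thesis .
  qed
  moreover have "(\<Sum>s\<in>S. real (?N s))\<^sup>2 \<le> (\<Sum>s\<in>S. (real (?N s))\<^sup>2) * card S"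
    by (rule sum_squared_le_sum_of_squares)
  ultimately show ?thesis
    by (simp add: mult.commute flip: of_nat_sum of_nat_power of_nat_mult)
qed

section \<open>Counting walks and tours\<close>

definition walks :: "('a, 'b) pre_digraph \<Rightarrow> nat \<Rightarrow> ('a \<times> 'b awalk) set" where
  "walks G k = {(u, p). (\<exists>v. pre_digraph.awalk G u p v) \<and> length p = k}"

context fin_digraph
begin

lemma walksD:
  assumes "(u, p) \<in> walks G k"
  shows "awalk u p (awlast u p)" "length p = k" "u \<in> verts G" "set p \<subseteq> arcs G"
    "awlast u p \<in> verts G"
  using assms by (auto simp: walks_def)

lemma finite_walks [simp]: "finite (walks G k)"
proof (rule finite_subset)
  show "walks G k \<subseteq> verts G \<times> {p. set p \<subseteq> arcs G \<and> length p = k}"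
    by (auto simp: walks_def)
qed (simp add: finite_lists_length_eq)

text \<open>Cut a walk after \<open>j\<close> arcs and let the second piece start where the first
  one ends. Joining the two arc lists recovers the walk, so the cut is injective.\<close>

lemma card_walks_add: "card (walks G (j + k)) \<le> card (walks G j) * card (walks G k)"
proof -
  let ?f = "\<lambda>(u, p). ((u, take j p), (awlast u (take j p), drop j p))"
  have "inj_on ?f (walks G (j + k))"
    by (rule inj_onI, clarsimp) (metis append_take_drop_id)
  moreover have "?f ` walks G (j + k) \<subseteq> walks G j \<times> walks G k"
  proof clarsimp
    fix u p assume up: "(u, p) \<in> walks G (j + k)"
    then have "awalk u (take j p @ drop j p) (awlast u p)"
      using walksD(1) by simp
    then show "(u, take j p) \<in> walks G j \<and> (awlast u (take j p), drop j p) \<in> walks G k"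
      using walksD(2)[OF up] unfolding awalk_append_iff walks_def by auto
  qed
  ultimately show ?thesis
    using card_inj_on_le[of ?f _ "walks G j \<times> walks G k"] by (simp add: card_cartesian_product)
qed

lemma even_tours_of_size_subset: "of_size tour_size (even_tours G) k \<subseteq> walks G (k + k)"
  by (auto simp: of_size_def tour_size_def tour_length_def even_tours_def tours_def walks_def)

text \<open>The parity comes from the size alone: size \<open>k\<close> forces length 2k.\<close>

lemma balanced_tours_of_size_subset:
  "of_size tour_size (balanced_tours G arev) k \<subseteq> of_size tour_size (even_tours G) k"
proof -
  have "even n" if "real n / 2 = real k" for n
  proof -
    have "n = 2 * k" using that by linarith
    then show ?thesis by simp
  qed
  then show ?thesis
    by (auto simp: of_size_def tour_size_def even_tours_def balanced_tours_def)
qed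

lemma finite_even_tours_of_size: "finite (of_size tour_size (even_tours G) k)"
  using even_tours_of_size_subset finite_walks by (rule finite_subset)

lemma card_even_tours_of_size_le:
  "card (of_size tour_size (even_tours G) k) \<le> (card (walks G k))\<^sup>2"
  using card_mono[OF finite_walks even_tours_of_size_subset, of k] card_walks_add[of k k]
  by (simp add: power2_eq_square)

end

section \<open>Gluing a walk to a reversed walk\<close>

context bidirected_digraph
begin

lemma awalk_map_arev_rev:
  assumes "awalk u p v"
  shows "awalk v (map arev (rev p)) u"
  using assms
proof (induction p arbitrary: u)
  case (Cons a p)
  then have "awalk v (map arev (rev p)) (head G a)" "a \<in> arcs G" "u = tail G a"
    by (auto simp: awalk_Cons_iff)
  moreover from this have "awalk (head G a) [arev a] u"
    by (auto simp: awalk_simps)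
  ultimately show ?case
    by (auto intro: awalk_appendI)
qed (auto simp: awalk_Nil_iff)

lemma count_list_map_arev: "count_list (map arev p) a = count_list p (arev a)"
  by (induction p) auto

end

text \<open>
  The restriction of the imbalance to \<open>arcs G\<close> keeps the set of signatures of walks of a given
  length finite.
\<close>
definition signature ::
  "('a, 'b) pre_digraph \<Rightarrow> ('b \<Rightarrow> 'b) \<Rightarrow> 'a \<times> 'b awalk \<Rightarrow> 'a \<times> 'a \<times> ('b \<Rightarrow> int)" where
  "signature G arev = (\<lambda>(u, p). (u, pre_digraph.awlast G u p,
     \<lambda>a\<in>arcs G. int (count_list p a) - int (count_list p (arev a))))"

context fin_graph
begin

text \<open>Each arc is counted between 0 and \<open>k\<close> times, so a difference of two counts
  has at most 2k + 1 values. For a fixed graph the number of possible signatures is thus polynomial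
  in \<open>k\<close>.\<close>

lemma signature_in:
  "signature G arev ` walks G k \<subseteq> verts G \<times> verts G \<times> (arcs G \<rightarrow>\<^sub>E {- int k..int k})"
proof (rule image_subsetI)
  fix x assume "x \<in> walks G k"
  then obtain u p where x: "x = (u, p)" and "(u, p) \<in> walks G k"
    by (cases x) auto
  note up = walksD[OF this(2)]
  have count: "int (count_list p a) \<le> int k" for a
    using count_le_length[of p a] up(2) by simp
  have "int (count_list p a) - int (count_list p (arev a)) \<in> {- int k..int k}" for a
    using count[of a] count[of "arev a"] by simp
  then show "signature G arev x \<in> verts G \<times> verts G \<times> (arcs G \<rightarrow>\<^sub>E {- int k..int k})"
    using up unfolding x signature_def by auto
qed

text \<open>Reversing \<open>q\<close> exchanges the counts of \<open>a\<close> and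
  \<open>arev a\<close>, hence negates its imbalances; they cancel those of \<open>p\<close>. Equal
  ends make the result closed.\<close>

lemma append_reverse_balanced:
  assumes "(u, p) \<in> walks G k" "(u', q) \<in> walks G k"
    and "signature G arev (u, p) = signature G arev (u', q)"
  shows "(u, p @ map arev (rev q)) \<in> of_size tour_size (balanced_tours G arev) k"
proof -
  have sig: "u' = u" "awlast u q = awlast u p" and imb: "\<And>a. a \<in> arcs G \<Longrightarrow>
      int (count_list p a) - int (count_list p (arev a)) =
      int (count_list q a) - int (count_list q (arev a))"
    using assms(3) by (auto simp: signature_def fun_eq_iff restrict_def split: if_splits)
  have "awalk u (p @ map arev (rev q)) u"
    using walksD(1)[OF assms(1)] awalk_map_arev_rev[OF walksD(1)[OF assms(2)]]
    unfolding sig by (rule awalk_appendI)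
  moreover have "balanced G arev (u, p @ map arev (rev q))"
    unfolding balanced_def
  proof
    fix a assume "a \<in> arcs G"
    from imb[OF this] show "count_list (snd (u, p @ map arev (rev q))) a =
        count_list (snd (u, p @ map arev (rev q))) (arev a)"
      by (simp add: count_list_map_arev count_list_rev)
  qed
  ultimately show ?thesis
    using walksD(2)[OF assms(1)] walksD(2)[OF assms(2)]
    by (simp add: of_size_def tour_size_def tour_length_def balanced_tours_def tours_def)
qed

text \<open>Pairs of walks with equal signatures are many by the collision inequality, and gluing
  maps them injectively to balanced tours.\<close>

lemma card_walks_power2_le:
  "(card (walks G k))\<^sup>2 \<le> (card (verts G))\<^sup>2 * (2 * k + 1) ^ card (arcs G)
     * card (of_size tour_size (balanced_tours G arev) k)"
proof -
  let ?S = "verts G \<times> verts G \<times> (arcs G \<rightarrow>\<^sub>E {- int k..int k})"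
  let ?C = "{(x, y) \<in> walks G k \<times> walks G k. signature G arev x = signature G arev y}"
  let ?B = "of_size tour_size (balanced_tours G arev) k"
  let ?f = "\<lambda>(x, y). (fst x, snd x @ map arev (rev (snd y)))"
  have "card {- int k..int k} = 2 * k + 1"
    by auto
  then have card_S: "card ?S = (card (verts G))\<^sup>2 * (2 * k + 1) ^ card (arcs G)"
    by (simp only: card_cartesian_product card_funcsetE[OF finite_arcs] power2_eq_square mult.assoc)
  have "(card (walks G k))\<^sup>2 \<le> card ?S * card ?C"
    by (intro card_power2_le_card_collisions signature_in) (auto intro!: finite_cartesian_product finite_PiE)
  also have "card ?C \<le> card ?B"
  proof (rule card_inj_on_le)
    have inj: "inj arev" using bij_arev by (rule bij_is_inj)
    show "inj_on ?f ?C"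
    proof (rule inj_onI)
      fix z z' assume C: "z \<in> ?C" "z' \<in> ?C" and eq: "?f z = ?f z'"
      obtain u p u1 q where z: "z = ((u, p), u1, q)" by (metis surj_pair)
      obtain v r v1 s where z': "z' = ((v, r), v1, s)" by (metis surj_pair)
      \<comment> \<open>Both halves have \<open>k\<close> arcs, so the glued list splits in only one
        way; the second start is determined because equal signatures include equal starts.\<close>
      have "length p = k" "length q = k" "length r = k" "length s = k" "u1 = u" "v1 = v"
        using C by (auto simp: z z' signature_def dest: walksD(2))
      then show "z = z'"
        using eq inj by (simp add: z z' inj_map_eq_map)
    qed
    show "?f ` ?C \<subseteq> ?B"
      using append_reverse_balanced by force
    show "finite ?B"
      using balanced_tours_of_size_subset finite_even_tours_of_size by (rule finite_subset)
  qed
  finally show ?thesis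
    unfolding card_S by simp
qed

end

section \<open>Squeezing both growth rates\<close>

theorem theorem2p8:
  fixes G :: "('a, 'b) pre_digraph" and arev :: "'b \<Rightarrow> 'b"
  assumes "fin_graph G arev"
    and "connected G"
  shows "\<exists>L. has_growth_rate tour_size (balanced_tours G arev) L
           \<and> has_growth_rate tour_size (even_tours G) L"
proof -
  interpret fin_graph G arev by fact
  let ?B = "of_size tour_size (balanced_tours G arev)"
  let ?E = "of_size tour_size (even_tours G)"
  define w where "w k = real (card (walks G k))" for k
  define P where "P k = (real (card (verts G)))\<^sup>2 * (2 * real k + 1) ^ card (arcs G)" for k
  have fin: "finite (?B k)" "finite (?E k)" for k
    using finite_subset[OF balanced_tours_of_size_subset finite_even_tours_of_size]
      finite_even_tours_of_size by this+
  obtain l where l: "(\<lambda>k. root k (w k)) \<longlonglongrightarrow> l"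
    using submultiplicative_root_tendsto[of w] card_walks_add
    by (auto simp: w_def simp flip: of_nat_mult)
  \<comment> \<open>Connectedness supplies a vertex, which makes \<open>P k\<close> positive: one
    can divide by it, and its roots tend to 1.\<close>
  have "verts G \<noteq> {}"
    using assms(2) by (auto simp: connected_def strongly_connected_def)
  then have verts: "real (card (verts G)) > 0"
    by (simp add: card_gt_0_iff)
  have P: "(\<lambda>k. root k (P k)) \<longlonglongrightarrow> 1"
    unfolding P_def by (intro root_polynomial_tendsto zero_less_power verts)
  have P_pos: "P k > 0" for k
    unfolding P_def using verts by (intro mult_pos_pos zero_less_power) auto
  have lower: "(w k)\<^sup>2 / P k \<le> card (?B k)" for k
  proof -
    have "(w k)\<^sup>2 \<le> P k * card (?B k)"
      using card_walks_power2_le[of k, folded of_nat_le_iff[where 'a = real]]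
      by (simp add: w_def P_def add.commute)
    then show ?thesis
      using P_pos[of k] by (simp add: field_simps)
  qed
  have mid: "real (card (?B k)) \<le> card (?E k)" for k
    by (intro of_nat_mono card_mono fin balanced_tours_of_size_subset)
  have upper: "card (?E k) \<le> (w k)\<^sup>2" for k
    using card_even_tours_of_size_le[of k, folded of_nat_le_iff[where 'a = real]]
    by (simp add: w_def)
  have lim_lower: "(\<lambda>k. root k ((w k)\<^sup>2 / P k)) \<longlonglongrightarrow> l\<^sup>2"
  proof -
    have "(\<lambda>k. (root k (w k))\<^sup>2 / root k (P k)) \<longlonglongrightarrow> l\<^sup>2 / 1"
      by (intro tendsto_intros l P) simp
    moreover have "\<forall>\<^sub>F k in sequentially.
        (root k (w k))\<^sup>2 / root k (P k) = root k ((w k)\<^sup>2 / P k)"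
      using eventually_gt_at_top[of 0]
      by eventually_elim (simp add: real_root_divide real_root_power)
    ultimately show ?thesis
      by (simp add: tendsto_cong)
  qed
  have lim_upper: "(\<lambda>k. root k ((w k)\<^sup>2)) \<longlonglongrightarrow> l\<^sup>2"
  proof -
    have "(\<lambda>k. (root k (w k))\<^sup>2) \<longlonglongrightarrow> l\<^sup>2"
      by (intro tendsto_intros l)
    moreover have "\<forall>\<^sub>F k in sequentially. (root k (w k))\<^sup>2 = root k ((w k)\<^sup>2)"
      using eventually_gt_at_top[of 0]
      by eventually_elim (simp add: real_root_power)
    ultimately show ?thesis
      by (simp add: tendsto_cong)
  qed
  \<comment> \<open>Stated for any \<open>f\<close>, since the chain \<open>lower\<close>,
    \<open>mid\<close>, \<open>upper\<close> puts both tour counts between the same two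
    bounds.\<close>
  have squeeze: "(\<lambda>k. root k (f k)) \<longlonglongrightarrow> l\<^sup>2"
    if "\<And>k. (w k)\<^sup>2 / P k \<le> f k" "\<And>k. f k \<le> (w k)\<^sup>2" for f
  proof (rule tendsto_sandwich[OF _ _ lim_lower lim_upper])
    show "\<forall>\<^sub>F k in sequentially. root k ((w k)\<^sup>2 / P k) \<le> root k (f k)"
      using eventually_gt_at_top[of 0] by eventually_elim (simp add: that)
    show "\<forall>\<^sub>F k in sequentially. root k (f k) \<le> root k ((w k)\<^sup>2)"
      using eventually_gt_at_top[of 0] by eventually_elim (simp add: that)
  qed
  have "(\<lambda>k. root k (card (?B k))) \<longlonglongrightarrow> l\<^sup>2"
    by (rule squeeze[OF lower order_trans[OF mid upper]])
  moreover have "(\<lambda>k. root k (card (?E k))) \<longlonglongrightarrow> l\<^sup>2"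
    by (rule squeeze[OF order_trans[OF lower mid] upper])
  ultimately show ?thesis
    using fin unfolding has_growth_rate_def by blast
qed

end
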